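(* Let $n\geq 1$ be a natural number, let $I\subset\mathbb{R}$ be an interval, let $f:I\to\mathbb{R}$ be $n$-times differentiable, and let $a,b\in I$ with $a<b$. If $f^{(n)}\in L[a,b]$ and $|f^{(n)}|^q$ is convex on $[a,b]$, then $$\left|\int_a^b f(t)\,dt-\sum_{k=0}^{n-1}\left(\frac{1+(-1)^k}{2^{k+1}(k+1)!}\right)(b-a)^{k+1}f^{(k)}\left(\frac{a+b}{2}\right)\right|$$ $$\leq \frac{(b-a)^{n+1}}{2^{n+1}n!}\left(\frac{1}{np+1}\right)^{\frac1p}\left\{\left(\frac{|f^{(n)}(a)|^q+3|f^{(n)}(b)|^q}{4}\right)^{\frac1q}+\left(\frac{3|f^{(n)}(a)|^q+|f^{(n)}(b)|^q}{4}\right)^{\frac1q}\right\},$$ where $\frac1p+\frac1q=1$.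
   Context: $f^{(k)}$ denotes the $k$-th derivative of $f$, with $f^{(0)}=f$; $L[a,b]$ denotes the space of (Lebesgue) integrable functions on $[a,b]$; $p$ and $q$ are real numbers. A function $g:[a,b]\to\mathbb{R}$ is convex if $g(tx+(1-t)y)\leq t g(x)+(1-t)g(y)$ for all $x,y\in[a,b]$ and $t\in[0,1]$.
   Formalization: The formal theorem additionally assumes p > 1 and q > 1; with only 1/p + 1/q = 1 the inequality fails, e.g. for n even, f^(n) = 1 and any nonzero p < 1 with np + 1 > 0. *)

theory Defs
  imports "HOL-Analysis.Analysis"
begin

text \<open>
  Derivatives are taken within \<open>I\<close>, hence one-sided at those endpoints that belong to \<open>I\<close>.
  If \<open>I\<close> is an interval with more than one point, derivatives within \<open>I\<close> are unique; if the
  derivative fails to exist, the value is unspecified.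
\<close>

primrec nth_deriv_on :: "real set \<Rightarrow> nat \<Rightarrow> (real \<Rightarrow> real) \<Rightarrow> real \<Rightarrow> real" where
  "nth_deriv_on I 0 f = f"
| "nth_deriv_on I (Suc k) f = (\<lambda>x. vector_derivative (nth_deriv_on I k f) (at x within I))"

definition times_differentiable_on :: "nat \<Rightarrow> (real \<Rightarrow> real) \<Rightarrow> real set \<Rightarrow> bool" where
  "times_differentiable_on n f I \<longleftrightarrow> (\<forall>k<n. nth_deriv_on I k f differentiable_on I)"

end

theory Submission
  imports Defs
begin

text \<open>
  For an endpoint \<open>c\<close>, the function \<open>\<Sum>k<n. (-1)^k (t - c)^(k+1) / (k+1)! f\<^sup>(\<^sup>k\<^sup>)(t)\<close> vanishes at \<open>c\<close> and
  is a primitive of \<open>f - (-1)^n (t - c)^n / n! f\<^sup>(\<^sup>n\<^sup>)\<close>, because its derivative telescopes. Taking \<open>c = a\<close>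
  on the left half of the interval and \<open>c = b\<close> on the right half, the values at the midpoint add up to
  the quadrature sum, and the error is a sum of two integrals \<open>\<integral> (t - c)^n f\<^sup>(\<^sup>n\<^sup>)\<close>. Hoelder's inequality bounds
  each of them, where \<open>\<bar>f\<^sup>(\<^sup>n\<^sup>)\<bar>\<^sup>q\<close> is replaced by its chord, an affine majorant by convexity. Since only
  this majorant is integrated, the gauge integral suffices.
\<close>

section \<open>Hoelder's inequality with integrable majorants\<close>

lemma Hoelder_majorant_pos:
  fixes u g :: "real \<Rightarrow> real"
  assumes p: "p > 1" and q: "q > 1" and pq: "1 / p + 1 / q = 1"
    and ug: "((\<lambda>t. u t * g t) has_integral J) S"
    and P: "(P has_integral U) S" "\<And>t. t \<in> S \<Longrightarrow> \<bar>u t\<bar> powr p \<le> P t"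
    and Q: "(Q has_integral V) S" "\<And>t. t \<in> S \<Longrightarrow> \<bar>g t\<bar> powr q \<le> Q t"
    and U: "U > 0" and V: "V > 0"
  shows "\<bar>J\<bar> \<le> U powr (1 / p) * V powr (1 / q)"
proof -
  define W where "W = U powr (1 / p) * V powr (1 / q)"
  have W: "W > 0"
    using U V by (simp add: W_def)
  \<comment> \<open>Young's inequality for the factors scaled by U^(1/p) and V^(1/q), which must be
    nonzero. \<open>P\<close> / U and \<open>Q\<close> / V integrate to 1, so the right side
    integrates to W (1/p + 1/q) = W.\<close>
  have bound: "norm (u t * g t) \<le> W * (P t / (p * U) + Q t / (q * V))" if "t \<in> S" for t
  proof -
    let ?x = "\<bar>u t\<bar> / U powr (1 / p)" and ?y = "\<bar>g t\<bar> / V powr (1 / q)"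
    have "?x * ?y \<le> ?x powr p / p + ?y powr q / q"
      using p q pq by (intro Youngs_inequality) auto
    also have "?x powr p = \<bar>u t\<bar> powr p / U"
      using p U by (simp add: powr_divide powr_powr)
    also have "?y powr q = \<bar>g t\<bar> powr q / V"
      using q V by (simp add: powr_divide powr_powr)
    also have "\<bar>u t\<bar> powr p / U / p + \<bar>g t\<bar> powr q / V / q \<le> P t / U / p + Q t / V / q"
      using P(2)[OF that] Q(2)[OF that] p q U V by (intro add_mono divide_right_mono) simp_all
    also have "\<dots> = P t / (p * U) + Q t / (q * V)"
      by (simp add: mult.commute)
    finally have "?x * ?y \<le> P t / (p * U) + Q t / (q * V)" .
    then have "W * (?x * ?y) \<le> W * (P t / (p * U) + Q t / (q * V))"
      using W by (intro mult_left_mono) auto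
    moreover have "W * (?x * ?y) = norm (u t * g t)"
      using U V by (simp add: W_def abs_mult)
    ultimately show ?thesis
      by simp
  qed
  have "((\<lambda>t. W * (P t / (p * U) + Q t / (q * V))) has_integral
      W * (U / (p * U) + V / (q * V))) S"
    by (intro has_integral_mult_right has_integral_add has_integral_divide P(1) Q(1))
  moreover have "W * (U / (p * U) + V / (q * V)) = W"
    using U V pq by simp
  ultimately have maj: "((\<lambda>t. W * (P t / (p * U) + Q t / (q * V))) has_integral W) S"
    by (simp only:)
  have "norm (integral S (\<lambda>t. u t * g t)) \<le> integral S (\<lambda>t. W * (P t / (p * U) + Q t / (q * V)))"
    using bound ug maj
    by (intro Henstock_Kurzweil_Integration.integral_norm_bound_integral)
      (auto simp: has_integral_integrable)
  then show ?thesis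
    unfolding integral_unique[OF ug] integral_unique[OF maj] by (simp add: W_def)
qed

text \<open>V = 0 would rule out the scaling by V^(1/q), so \<open>Q\<close> is lifted by a constant
  e > 0. This replaces V by V + e (r - l) > 0, and then e tends to 0.\<close>

lemma Hoelder_majorant:
  fixes u g :: "real \<Rightarrow> real"
  assumes p: "p > 1" and q: "q > 1" and pq: "1 / p + 1 / q = 1"
    and ug: "((\<lambda>t. u t * g t) has_integral J) {l..r}"
    and P: "(P has_integral U) {l..r}" "\<And>t. t \<in> {l..r} \<Longrightarrow> \<bar>u t\<bar> powr p \<le> P t"
    and Q: "(Q has_integral V) {l..r}" "\<And>t. t \<in> {l..r} \<Longrightarrow> \<bar>g t\<bar> powr q \<le> Q t"
    and U: "U > 0" and lr: "l < r"
  shows "\<bar>J\<bar> \<le> U powr (1 / p) * V powr (1 / q)"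
proof -
  have V: "V \<ge> 0"
    using Q(2) by (intro has_integral_nonneg[OF Q(1)] order_trans[OF powr_ge_zero])
  \<comment> \<open>The limiting base V may be 0. Since 1/q > 0, \<open>powr\<close> is continuous
    there along nonnegative bases.\<close>
  have "((\<lambda>e. U powr (1 / p) * (V + e * (r - l)) powr (1 / q)) \<longlongrightarrow>
      U powr (1 / p) * (V + 0 * (r - l)) powr (1 / q)) (at_right 0)"
    using V q lr
    by (intro tendsto_intros) (auto simp: eventually_at_filter)
  moreover have "\<forall>\<^sub>F e in at_right 0. \<bar>J\<bar> \<le> U powr (1 / p) * (V + e * (r - l)) powr (1 / q)"
    unfolding eventually_at_filter
  proof (intro always_eventually allI impI)
    fix e :: real
    assume "e \<in> {0<..}"
    then have e: "e > 0"
      by simp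
    have "((\<lambda>t. Q t + e) has_integral V + e * (r - l)) {l..r}"
      using has_integral_add[OF Q(1) has_integral_const_real[of e l r]] lr by (simp add: mult.commute)
    moreover have "\<bar>g t\<bar> powr q \<le> Q t + e" if "t \<in> {l..r}" for t
      using Q(2)[OF that] e by simp
    moreover have "V + e * (r - l) > 0"
      using V e lr by (intro add_nonneg_pos mult_pos_pos) auto
    ultimately show "\<bar>J\<bar> \<le> U powr (1 / p) * (V + e * (r - l)) powr (1 / q)"
      using Hoelder_majorant_pos[OF p q pq ug P] U by blast
  qed
  ultimately have "\<bar>J\<bar> \<le> U powr (1 / p) * (V + 0 * (r - l)) powr (1 / q)"
    by (rule tendsto_lowerbound) simp
  then show ?thesis
    by simp
qed

section \<open>The weight, affine majorants and the estimate on one interval\<close>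

lemma has_integral_abs_powr_endpoint:
  fixes l r c s :: real
  assumes lr: "l < r" and c: "c = l \<or> c = r" and s: "s > 0"
  shows "((\<lambda>t. \<bar>t - c\<bar> powr s) has_integral (r - l) powr (s + 1) / (s + 1)) {l..r}"
  using c
proof
  assume "c = l"
  \<comment> \<open>The antiderivative is differentiated in the interior only, where the base is
    positive. At t = c its continuity suffices, and this comes from s + 1 > 0.\<close>
  have "((\<lambda>t. \<bar>t - l\<bar> powr s) has_integral
      (r - l) powr (s + 1) / (s + 1) - (l - l) powr (s + 1) / (s + 1)) {l..r}"
  proof (rule fundamental_theorem_of_calculus_interior)
    show "continuous_on {l..r} (\<lambda>t. (t - l) powr (s + 1) / (s + 1))"
      using s by (intro continuous_on_divide continuous_on_powr' continuous_intros) auto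
    show "((\<lambda>t. (t - l) powr (s + 1) / (s + 1)) has_vector_derivative \<bar>t - l\<bar> powr s) (at t)"
      if "t \<in> {l<..<r}" for t
      unfolding has_real_derivative_iff_has_vector_derivative[symmetric]
      using that s by (auto intro!: derivative_eq_intros)
  qed (use lr in auto)
  then show ?thesis
    using \<open>c = l\<close> s by simp
next
  assume "c = r"
  have "((\<lambda>t. \<bar>t - r\<bar> powr s) has_integral
      - ((r - r) powr (s + 1) / (s + 1)) - - ((r - l) powr (s + 1) / (s + 1))) {l..r}"
  proof (rule fundamental_theorem_of_calculus_interior)
    show "continuous_on {l..r} (\<lambda>t. - ((r - t) powr (s + 1) / (s + 1)))"
      using s by (intro continuous_on_minus continuous_on_divide continuous_on_powr' continuous_intros) auto
    show "((\<lambda>t. - ((r - t) powr (s + 1) / (s + 1))) has_vector_derivative \<bar>t - r\<bar> powr s) (at t)"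
      if "t \<in> {l<..<r}" for t
      unfolding has_real_derivative_iff_has_vector_derivative[symmetric]
      using that s by (auto intro!: derivative_eq_intros)
  qed (use lr in auto)
  then show ?thesis
    using \<open>c = r\<close> s by simp
qed

text \<open>The mean of an affine function is its value at the midpoint. The length is kept as a
  separate factor to match the form (r - l) M in \<open>endpoint_weight_bound\<close>.\<close>

lemma has_integral_affine:
  fixes l r s x y :: real
  assumes "l \<le> r"
  shows "((\<lambda>t. s * (t - x) + y) has_integral (r - l) * (s * ((l + r) / 2 - x) + y)) {l..r}"
proof -
  have "((\<lambda>t. s * (t - x) + y) has_integral
      (s * (r - x)\<^sup>2 / 2 + y * r) - (s * (l - x)\<^sup>2 / 2 + y * l)) {l..r}"
    using assms
    by (intro fundamental_theorem_of_calculus)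
      (auto intro!: derivative_eq_intros simp flip: has_real_derivative_iff_has_vector_derivative)
  moreover have "(s * (r - x)\<^sup>2 / 2 + y * r) - (s * (l - x)\<^sup>2 / 2 + y * l) =
      (r - l) * (s * ((l + r) / 2 - x) + y)"
    by (simp add: field_simps power2_eq_square)
  ultimately show ?thesis
    by simp
qed

text \<open>Hoelder with U = (r - l)^(np+1) / (np+1) and V = (r - l) M. The exponents of r - l add
  up to (np+1)/p + 1/q = n + 1.\<close>

lemma endpoint_weight_bound:
  fixes g :: "real \<Rightarrow> real"
  assumes p: "p > 1" and q: "q > 1" and pq: "1 / p + 1 / q = 1"
    and n: "n \<ge> 1" and lr: "l < r" and c: "c = l \<or> c = r"
    and J: "((\<lambda>t. (t - c) ^ n * g t) has_integral J) {l..r}"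
    and Q: "(Q has_integral (r - l) * M) {l..r}" "\<And>t. t \<in> {l..r} \<Longrightarrow> \<bar>g t\<bar> powr q \<le> Q t"
    and M: "M \<ge> 0"
  shows "\<bar>J\<bar> \<le> (r - l) ^ (n + 1) * (1 / (real n * p + 1)) powr (1 / p) * M powr (1 / q)"
proof -
  let ?s = "real n * p"
  have s: "?s > 0"
    using n p by simp
  \<comment> \<open>At t = c both sides are 0 because n >= 1; for n = 0 the left side would be 1,
    while \<open>0 powr 0\<close> is 0.\<close>
  have "\<bar>(t - c) ^ n\<bar> powr p = \<bar>t - c\<bar> powr ?s" for t
    using n by (cases "t = c") (simp_all add: power_abs powr_powr flip: powr_realpow[of "\<bar>t - c\<bar>"])
  then have "\<bar>J\<bar> \<le> ((r - l) powr (?s + 1) / (?s + 1)) powr (1 / p) * ((r - l) * M) powr (1 / q)"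
    using Hoelder_majorant[OF p q pq J has_integral_abs_powr_endpoint[OF lr c s] _ Q] lr s
    by simp
  also have "\<dots> = (r - l) powr ((?s + 1) / p) * (1 / (?s + 1)) powr (1 / p) *
      ((r - l) powr (1 / q) * M powr (1 / q))"
    using lr M s p by (simp add: powr_divide powr_mult powr_powr)
  also have "\<dots> = (r - l) powr ((?s + 1) / p + 1 / q) * (1 / (?s + 1)) powr (1 / p) * M powr (1 / q)"
    by (simp add: powr_add)
  also have "(?s + 1) / p + 1 / q = real (n + 1)"
    using pq p by (simp add: add_divide_distrib)
  also have "(r - l) powr real (n + 1) = (r - l) ^ (n + 1)"
    using lr by (subst powr_realpow) auto
  finally show ?thesis .
qed

section \<open>Expansion of the integral about an endpoint\<close>

lemma times_differentiable_on_has_vector_derivative: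
  assumes "times_differentiable_on n f I" "k < n" "x \<in> I"
  shows "(nth_deriv_on I k f has_vector_derivative nth_deriv_on I (Suc k) f x) (at x within I)"
  using assms
  by (auto simp: times_differentiable_on_def differentiable_on_def vector_derivative_works)

text \<open>\<open>D n\<close> is known only as a derivative. The fundamental theorem for the gauge
  integral itself yields the integrability of the remainder term.\<close>

lemma has_integral_endpoint_expansion:
  fixes D :: "nat \<Rightarrow> real \<Rightarrow> real"
    and c :: real
  assumes D: "\<And>k t. k < n \<Longrightarrow> t \<in> {l..r} \<Longrightarrow>
      (D k has_vector_derivative D (Suc k) t) (at t within {l..r})"
    and lr: "l \<le> r"
  defines "G \<equiv> \<lambda>t. \<Sum>k<n. (- 1) ^ k * ((t - c) ^ (k + 1) / fact (k + 1) * D k t)"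
  shows "((\<lambda>t. D 0 t - (- 1) ^ n * (t - c) ^ n / fact n * D n t) has_integral G r - G l) {l..r}"
proof (rule fundamental_theorem_of_calculus[OF lr])
  fix t
  assume t: "t \<in> {l..r}"
  let ?T = "\<lambda>k. (- 1) ^ k * (t - c) ^ k / fact k * D k t"
  \<comment> \<open>The second term of the product rule has the power and factorial of index k + 1
    but the sign (-1)^k, so it equals - \<open>?T (Suc k)\<close>.\<close>
  have step: "((\<lambda>t. (- 1) ^ k * ((t - c) ^ (k + 1) / fact (k + 1) * D k t)) has_real_derivative
      ?T k - ?T (Suc k)) (at t within {l..r})" if "k < n" for k
  proof -
    have "((\<lambda>t. (t - c) ^ (k + 1) / fact (k + 1)) has_real_derivative (t - c) ^ k / fact k)
        (at t within {l..r})"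
      by (rule derivative_eq_intros refl | simp del: of_nat_Suc)+
    from DERIV_cmult[OF DERIV_mult[OF this
        D[OF that t, folded has_real_derivative_iff_has_vector_derivative]], of "(- 1) ^ k"]
    show ?thesis
      by (rule DERIV_cong) (simp add: ring_distribs diff_divide_distrib mult_ac del: fact_Suc)
  qed
  have "(G has_real_derivative (\<Sum>k<n. ?T k - ?T (Suc k))) (at t within {l..r})"
    unfolding G_def using step by (intro DERIV_sum) auto
  also have "(\<Sum>k<n. ?T k - ?T (Suc k)) = D 0 t - ?T n"
    using sum_lessThan_telescope'[of ?T n] by simp
  finally show "(G has_vector_derivative D 0 t - ?T n) (at t within {l..r})"
    by (simp add: has_real_derivative_iff_has_vector_derivative)
qed

section \<open>The midpoint error as a sum of two half-interval errors\<close>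

theorem theorem2:
  fixes n :: nat and I :: "real set" and f :: "real \<Rightarrow> real" and a b p q :: real
  assumes "n \<ge> 1"
    and "is_interval I"
    and "times_differentiable_on n f I"
    and "a \<in> I" and "b \<in> I" and "a < b"
    and "p > 1" and "q > 1" and "1 / p + 1 / q = 1"
    and "set_integrable lebesgue {a..b} (nth_deriv_on I n f)"
    and "convex_on {a..b} (\<lambda>x. \<bar>nth_deriv_on I n f x\<bar> powr q)"
  shows "\<bar>(LINT t:{a..b}|lebesgue. f t)
          - (\<Sum>k<n. ((1 + (-1) ^ k) / (2 ^ (k + 1) * fact (k + 1))) * (b - a) ^ (k + 1)
                     * nth_deriv_on I k f ((a + b) / 2))\<bar>
    \<le> (b - a) ^ (n + 1) / (2 ^ (n + 1) * fact n) * (1 / (real n * p + 1)) powr (1 / p)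
      * (((\<bar>nth_deriv_on I n f a\<bar> powr q + 3 * \<bar>nth_deriv_on I n f b\<bar> powr q) / 4) powr (1 / q)
         + ((3 * \<bar>nth_deriv_on I n f a\<bar> powr q + \<bar>nth_deriv_on I n f b\<bar> powr q) / 4) powr (1 / q))"
proof -
  define D where "D = (\<lambda>k. nth_deriv_on I k f)"
  define m where "m = (a + b) / 2"
  define A where "A = \<bar>D n a\<bar> powr q"
  define B where "B = \<bar>D n b\<bar> powr q"
  \<comment> \<open>The chord of the convex function, with value A at a and B at b.\<close>
  define Q where "Q = (\<lambda>t. (B - A) / (b - a) * (t - a) + A)"
  define G where "G = (\<lambda>c t. \<Sum>k<n. (- 1) ^ k * ((t - c) ^ (k + 1) / fact (k + 1) * D k t))"
  define C where "C = (1 / (real n * p + 1)) powr (1 / p)"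
  define h where "h = (b - a) / 2"
  have am: "a < m" and mb: "m < b" and h: "m - a = h" "b - m = h" "h > 0"
    using \<open>a < b\<close> by (auto simp: m_def h_def field_simps)
  have sub: "{a..b} \<subseteq> I"
    using assms(2,4,5) by (meson atLeastAtMost_iff is_interval_1 subsetI)
  have D: "(D k has_vector_derivative D (Suc k) t) (at t within T)"
    if "k < n" "t \<in> T" "T \<subseteq> {a..b}" for k t T
    unfolding D_def
    using that sub assms(3)
    by (intro has_vector_derivative_within_subset
        [OF times_differentiable_on_has_vector_derivative]) auto

  \<comment> \<open>As n >= 1, f is differentiable and hence continuous, so its Lebesgue and gauge
    integrals agree.\<close>
  have "continuous_on {a..b} (D 0)"
    unfolding continuous_on_eq_continuous_within
    using assms(1) by (auto intro: has_vector_derivative_continuous[OF D])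
  then have "continuous_on {a..b} f"
    by (simp add: D_def)
  then have absint: "f absolutely_integrable_on {a..b}" and int: "f integrable_on {a..b}"
    by (auto intro: absolutely_integrable_continuous_real integrable_continuous_real)
  have LINT: "(LINT t:{a..b}|lebesgue. f t) = integral {a..b} f"
    using absint by (rule set_lebesgue_integral_eq_integral(2))

  have Q_maj: "\<bar>D n t\<bar> powr q \<le> Q t" if "t \<in> {a..b}" for t
    using convex_onD_Icc'[OF assms(11) that] by (simp add: Q_def A_def B_def D_def)
  \<comment> \<open>Both halves have length h, so one estimate serves both, with c = l = a on the
    left and c = r = b on the right.\<close>
  have half: "\<bar>integral {l..r} f - (G c r - G c l)\<bar> \<le>
      h ^ (n + 1) / fact n * C * ((B - A) / (b - a) * ((l + r) / 2 - a) + A) powr (1 / q)"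
    if lr: "l < r" "r - l = h" "{l..r} \<subseteq> {a..b}" and c: "c = l \<or> c = r" for l r c
  proof -
    let ?M = "(B - A) / (b - a) * ((l + r) / 2 - a) + A"
    have "((\<lambda>t. D 0 t - (- 1) ^ n * (t - c) ^ n / fact n * D n t) has_integral G c r - G c l) {l..r}"
      unfolding G_def using D lr by (intro has_integral_endpoint_expansion) auto
    then have GI: "((\<lambda>t. f t - (- 1) ^ n * (t - c) ^ n / fact n * D n t) has_integral
        G c r - G c l) {l..r}"
      by (simp add: D_def)
    have fI: "(f has_integral integral {l..r} f) {l..r}"
      using int lr integrable_on_subinterval by blast
    \<comment> \<open>The factor undoes (-1)^n / n!, since (-1)^n is its own inverse, and isolates
      the integral of (t - c)^n \<open>D n\<close>.\<close>
    define J where "J = (- 1) ^ n * fact n * (integral {l..r} f - (G c r - G c l))"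
    have "((\<lambda>t. (- 1) ^ n * fact n * (f t - (f t - (- 1) ^ n * (t - c) ^ n / fact n * D n t)))
        has_integral J) {l..r}"
      unfolding J_def by (intro has_integral_mult_right has_integral_diff fI GI)
    moreover have "(- 1) ^ n * fact n * (f t - (f t - (- 1) ^ n * (t - c) ^ n / fact n * D n t)) =
        (t - c) ^ n * D n t" for t
      by (simp flip: power_mult_distrib)
    ultimately have J: "((\<lambda>t. (t - c) ^ n * D n t) has_integral J) {l..r}"
      by simp
    have QI: "(Q has_integral (r - l) * ?M) {l..r}"
      unfolding Q_def using lr by (intro has_integral_affine) auto
    have "?M = Q ((l + r) / 2)"
      by (simp add: Q_def)
    moreover have "(l + r) / 2 \<in> {a..b}"
      using lr(1,3) by auto
    ultimately have "?M \<ge> 0"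
      using order_trans[OF powr_ge_zero Q_maj] by simp
    then have "\<bar>J\<bar> \<le> h ^ (n + 1) * C * ?M powr (1 / q)"
      using endpoint_weight_bound[OF assms(7-9,1) lr(1) c J QI] Q_maj lr by (auto simp: C_def)
    moreover have "\<bar>J\<bar> = fact n * \<bar>integral {l..r} f - (G c r - G c l)\<bar>"
      by (simp add: J_def abs_mult power_abs)
    ultimately show ?thesis
      by (simp add: field_simps)
  qed

  have "G a m - G b m = (\<Sum>k<n. ((1 + (- 1) ^ k) / (2 ^ (k + 1) * fact (k + 1))) * (b - a) ^ (k + 1)
                     * nth_deriv_on I k f m)" (is "_ = ?S")
  proof -
    have "(- 1) ^ k * ((m - a) ^ (k + 1) / fact (k + 1) * D k m) -
        (- 1) ^ k * ((m - b) ^ (k + 1) / fact (k + 1) * D k m) =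
        ((1 + (- 1) ^ k) / (2 ^ (k + 1) * fact (k + 1))) * (b - a) ^ (k + 1) * D k m" for k
    proof -
      have mb: "m - b = - h"
        using h by simp
      \<comment> \<open>With (-1)^k (-1)^(k+1) = -1, the difference of the two values at m carries 1
        + (-1)^k: odd k cancel and even k double.\<close>
      have "(- 1) ^ k * (- h) ^ (k + 1) = - (h ^ (k + 1))"
        by (subst power_minus) (simp flip: power_mult_distrib)
      then have "(- 1) ^ k * (h ^ (k + 1) / fact (k + 1) * D k m) -
          (- 1) ^ k * ((- h) ^ (k + 1) / fact (k + 1) * D k m) =
          (1 + (- 1) ^ k) * h ^ (k + 1) / fact (k + 1) * D k m"
        by (simp add: ring_distribs add_divide_distrib mult_ac del: power_Suc fact_Suc)
      also have "\<dots> = ((1 + (- 1) ^ k) / (2 ^ (k + 1) * fact (k + 1))) * (b - a) ^ (k + 1) * D k m"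
        unfolding h_def power_divide by (simp del: power_Suc fact_Suc)
      finally show ?thesis
        unfolding h mb .
    qed
    then show ?thesis
      unfolding G_def sum_subtractf[symmetric] by (simp add: D_def)
  qed
  moreover have "G a a = 0" "G b b = 0"
    by (simp_all add: G_def)
  moreover have "integral {a..b} f = integral {a..m} f + integral {m..b} f"
    using Henstock_Kurzweil_Integration.integral_combine[of a m b f] am mb int by simp
  ultimately have "\<bar>integral {a..b} f - ?S\<bar> \<le>
      \<bar>integral {a..m} f - (G a m - G a a)\<bar> + \<bar>integral {m..b} f - (G b b - G b m)\<bar>"
    by linarith
  also have "\<dots> \<le>
      h ^ (n + 1) / fact n * C * ((B - A) / (b - a) * ((a + m) / 2 - a) + A) powr (1 / q) +
      h ^ (n + 1) / fact n * C * ((B - A) / (b - a) * ((m + b) / 2 - a) + A) powr (1 / q)"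
    using am mb h by (intro add_mono half) auto
  \<comment> \<open>The midpoints of the halves are the quarter points of [a,b], where the chord has
    weights 3/4 and 1/4.\<close>
  also have "(B - A) / (b - a) * ((a + m) / 2 - a) + A = (3 * A + B) / 4"
    using \<open>a < b\<close> by (simp add: m_def field_simps)
  also have "(B - A) / (b - a) * ((m + b) / 2 - a) + A = (A + 3 * B) / 4"
    using \<open>a < b\<close> by (simp add: m_def field_simps)
  also have "h ^ (n + 1) / fact n * C * ((3 * A + B) / 4) powr (1 / q) +
      h ^ (n + 1) / fact n * C * ((A + 3 * B) / 4) powr (1 / q) =
      (b - a) ^ (n + 1) / (2 ^ (n + 1) * fact n) * C *
        (((A + 3 * B) / 4) powr (1 / q) + ((3 * A + B) / 4) powr (1 / q))"
    by (simp add: h_def power_divide algebra_simps)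
  finally show ?thesis
    unfolding LINT A_def B_def C_def D_def m_def .
qed

end
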